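(* Let $\phi$ be an updating rule and $\mathcal{P}$ a class of true densities. Assume: (1) $\Theta\subseteq\mathbb{R}^k$ is open and convex, $\vartheta_{t|t-1}\in\Theta$ and $\vartheta_{t|t}(Y_t)=\phi(Y_t,\vartheta_{t|t-1})\in\Theta$ (almost surely); (2) $\log f(x|\vartheta)$ is twice continuously differentiable in $\vartheta$ for all $\vartheta\in\Theta$ and $x\in\mathcal{Y}$; (3) $\mathbb{E}_{p_t}[s(X_t,\vartheta_{t|t-1})]$ and $\mathbb{E}_{p_t}[\|\Delta\phi(Y_t,\vartheta_{t|t-1})\|^2]$ are finite for all $\vartheta_{t|t-1}\in\Theta$ and $p_t\in\mathcal{P}$; (4) for any $\vartheta_{t|t-1}\in\Theta$ there exists a compact ball $\widetilde\Theta_r(\vartheta_{t|t-1})\subset\Theta$ around $\vartheta_{t|t-1}$ with radius $r>0$ such that $\sup_{\vartheta\in\widetilde\Theta_r(\vartheta_{t|t-1})}\|\mathbb{E}_{p_t}[H(X_t,\vartheta)]\|<\infty$ for all $p_t\in\mathcal{P}$; (5) the update is bounded: $\|\Delta\phi(Y_t,\vartheta_{t|t-1})\|\le d(\vartheta_{t|t-1})<\infty$ (almost surely), for some function $d$ of $\vartheta_{t|t-1}$. Then, for any $\vartheta_{t|t-1}\in\Theta$ and $p_t\in\mathcal{P}$ such that $\mathbb{E}_{p_t}[\Delta\phi(Y_t,\vartheta_{t|t-1})]^\top\,\mathbb{E}_{p_t}[s(X_t,\vartheta_{t|t-1})]\neq 0$, the following are equivalent: (a) $\mathbb{E}_{p_t}[\Delta\phi(Y_t,\vartheta_{t|t-1})]^\top\,\mathbb{E}_{p_t}[s(X_t,\vartheta_{t|t-1})]>0$;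 (b) there exists $\bar\kappa>0$ (with $\bar\kappa\le 1$) such that for all $\kappa\in(0,\bar\kappa]$: $\Delta^{\mathsf{EKL}}(\phi_\kappa|\vartheta_{t|t-1},p_t)<0$.
   Context: Setting. Let $\mathcal{Y}\subseteq\mathbb{R}^l$ be the outcome space and fix a time $t$. Conditionally on the information set $\mathcal{F}_{t-1}$ at time $t-1$, the observation $Y_t$ has true density $p_t$ on $\mathcal{Y}$, belonging to a class $\mathcal{P}$ of absolutely continuous distributions (identified with their densities). Quantities known given $\mathcal{F}_{t-1}$, such as the predicted parameter $\vartheta_{t|t-1}\in\Theta$, are treated as fixed. $\mathbb{E}_{p_t}$ denotes expectation under $p_t$, and $X_t$ denotes an independent copy of $Y_t$. The postulated (possibly misspecified) model is a family of densities $f(\cdot|\vartheta)$, $\vartheta\in\Theta\subseteq\mathbb{R}^k$; the support of $p_t$ is assumed to be contained in the support of $f(\cdot|\vartheta)$ for all $\vartheta\in\Theta$. The score is $s(y,\vartheta)=\frac{\partial}{\partial\vartheta}\log f(y|\vartheta)$ and the Hessian is $H(x,\vartheta)=\frac{\partial^2}{\partial\vartheta\,\partial\vartheta^\top}\log f(x|\vartheta)$. $\|\cdot\|$ is the Euclidean norm for vectors and the spectral norm for matrices. Updating rules. An updating rule is a map $\phi:\mathcal{Y}\times\Theta\to\Theta$; the updated parameter is $\vartheta_{t|t}(y)=\phi(y,\vartheta_{t|t-1})$ and $\Delta\phi(y,\vartheta_{t|t-1}):=\vartheta_{t|t}(y)-\vartheta_{t|t-1}$. For $0<\kappa\le 1$,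 the linearly downscaled rule $\phi_\kappa$ is $\phi_\kappa(y,\vartheta_{t|t-1})=\vartheta_{t|t-1}+\kappa\,\Delta\phi(y,\vartheta_{t|t-1})$. EKL. For an updating rule $\phi$ with $\vartheta_{t|t}(y)=\phi(y,\vartheta_{t|t-1})$, $$\mathsf{EKL}(p_t\Vert f_{t|t}):=\int_{\mathcal{Y}}\int_{\mathcal{Y}}\log\Big(\frac{p_t(x)}{f(x|\vartheta_{t|t}(y))}\Big)p_t(x)\,p_t(y)\,dx\,dy,$$ $$\mathsf{EKL}(p_t\Vert f_{t|t-1})=\int_{\mathcal{Y}}\log\Big(\frac{p_t(x)}{f(x|\vartheta_{t|t-1})}\Big)p_t(x)\,dx,$$ assumed finite throughout, and $\Delta^{\mathsf{EKL}}(\phi|\vartheta_{t|t-1},p_t):=\mathsf{EKL}(p_t\Vert f_{t|t})-\mathsf{EKL}(p_t\Vert f_{t|t-1})$.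
   Formalization: Added assumption: for each predicted parameter θ and p_t there is r>0 such that H(x,θ+uv) is jointly integrable in (x,u) under p_t(x)dx du, u in [0,1], for all ‖v‖≤r. With (4) bounding only the norm of the expected Hessian, the claim is false: the expected score may jump at θ. *)

theory Defs
  imports "HOL-Probability.Probability"
begin

definition gradient :: "(real^'k \<Rightarrow> real) \<Rightarrow> real^'k \<Rightarrow> real^'k" where
  "gradient g \<theta> = (\<chi> i. frechet_derivative g (at \<theta>) (axis i 1))"

definition hessian :: "(real^'k \<Rightarrow> real) \<Rightarrow> real^'k \<Rightarrow> real^'k^'k" where
  "hessian g \<theta> = jacobian (gradient g) (at \<theta>)"

text \<open>Only meant for open \<open>S\<close>, since the derivatives are taken in the whole space.\<close>

definition twice_continuously_differentiable_on ::
    "(real^'k \<Rightarrow> real) \<Rightarrow> (real^'k) set \<Rightarrow> bool" where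
  "twice_continuously_differentiable_on g S \<longleftrightarrow>
     (\<forall>\<theta>\<in>S. g differentiable (at \<theta>)) \<and>
     (\<forall>\<theta>\<in>S. gradient g differentiable (at \<theta>)) \<and>
     continuous_on S (hessian g)"

text \<open>The type class norm of \<open>real^'k^'k\<close> is the Frobenius norm, hence the
  operator norm is named explicitly.\<close>

definition spectral_norm :: "real^'k^'k \<Rightarrow> real" where
  "spectral_norm A = onorm (\<lambda>v. A *v v)"

definition density_on :: "(real^'l) set \<Rightarrow> (real^'l \<Rightarrow> real) \<Rightarrow> bool" where
  "density_on Y q \<longleftrightarrow>
     q \<in> borel_measurable (lebesgue_on Y) \<and> (\<forall>x\<in>Y. 0 \<le> q x) \<and>
     (\<integral>\<^sup>+x. ennreal (q x) \<partial>lebesgue_on Y) = 1"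

text \<open>The distribution on \<open>Y\<close> with Lebesgue density \<open>p\<close>. It is the law of \<open>Y\<^sub>t\<close> and of its
  independent copy \<open>X\<^sub>t\<close>, so expectations under \<open>p\<close> are integrals against it.\<close>

definition law :: "(real^'l) set \<Rightarrow> (real^'l \<Rightarrow> real) \<Rightarrow> (real^'l) measure" where
  "law Y p = density (lebesgue_on Y) (\<lambda>x. ennreal (p x))"

definition score :: "(real^'l \<Rightarrow> real^'k \<Rightarrow> real) \<Rightarrow> real^'l \<Rightarrow> real^'k \<Rightarrow> real^'k" where
  "score f y \<theta> = gradient (\<lambda>\<theta>. ln (f y \<theta>)) \<theta>"

definition score_hessian ::
    "(real^'l \<Rightarrow> real^'k \<Rightarrow> real) \<Rightarrow> real^'l \<Rightarrow> real^'k \<Rightarrow> real^'k^'k" where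
  "score_hessian f x \<theta> = hessian (\<lambda>\<theta>. ln (f x \<theta>)) \<theta>"

definition update_step ::
    "(real^'l \<Rightarrow> real^'k \<Rightarrow> real^'k) \<Rightarrow> real^'l \<Rightarrow> real^'k \<Rightarrow> real^'k" where
  "update_step \<phi> y \<theta> = \<phi> y \<theta> - \<theta>"

definition downscaled ::
    "(real^'l \<Rightarrow> real^'k \<Rightarrow> real^'k) \<Rightarrow> real \<Rightarrow> real^'l \<Rightarrow> real^'k \<Rightarrow> real^'k" where
  "downscaled \<phi> \<kappa> y \<theta> = \<theta> + \<kappa> *\<^sub>R update_step \<phi> y \<theta>"

definition KL_pred ::
    "(real^'l) set \<Rightarrow> (real^'l \<Rightarrow> real) \<Rightarrow> (real^'l \<Rightarrow> real^'k \<Rightarrow> real) \<Rightarrow> real^'k \<Rightarrow> real" where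
  "KL_pred Y p f \<theta> = (\<integral>x. ln (p x / f x \<theta>) \<partial>law Y p)"

definition EKL ::
    "(real^'l) set \<Rightarrow> (real^'l \<Rightarrow> real) \<Rightarrow> (real^'l \<Rightarrow> real^'k \<Rightarrow> real) \<Rightarrow>
     (real^'l \<Rightarrow> real^'k \<Rightarrow> real^'k) \<Rightarrow> real^'k \<Rightarrow> real" where
  "EKL Y p f \<phi> \<theta> = (\<integral>y. (\<integral>x. ln (p x / f x (\<phi> y \<theta>)) \<partial>law Y p) \<partial>law Y p)"

text \<open>The Bochner integral of a non-integrable function is \<open>0\<close>, so finiteness of the divergences
  is stated through integrability.\<close>

definition KL_pred_finite ::
    "(real^'l) set \<Rightarrow> (real^'l \<Rightarrow> real) \<Rightarrow> (real^'l \<Rightarrow> real^'k \<Rightarrow> real) \<Rightarrow> real^'k \<Rightarrow> bool" where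
  "KL_pred_finite Y p f \<theta> \<longleftrightarrow> integrable (law Y p) (\<lambda>x. ln (p x / f x \<theta>))"

definition EKL_finite ::
    "(real^'l) set \<Rightarrow> (real^'l \<Rightarrow> real) \<Rightarrow> (real^'l \<Rightarrow> real^'k \<Rightarrow> real) \<Rightarrow>
     (real^'l \<Rightarrow> real^'k \<Rightarrow> real^'k) \<Rightarrow> real^'k \<Rightarrow> bool" where
  "EKL_finite Y p f \<phi> \<theta> \<longleftrightarrow>
     (AE y in law Y p. integrable (law Y p) (\<lambda>x. ln (p x / f x (\<phi> y \<theta>)))) \<and>
     integrable (law Y p) (\<lambda>y. \<integral>x. ln (p x / f x (\<phi> y \<theta>)) \<partial>law Y p)"

definition Delta_EKL ::
    "(real^'l) set \<Rightarrow> (real^'l \<Rightarrow> real) \<Rightarrow> (real^'l \<Rightarrow> real^'k \<Rightarrow> real) \<Rightarrow>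
     (real^'l \<Rightarrow> real^'k \<Rightarrow> real^'k) \<Rightarrow> real^'k \<Rightarrow> real" where
  "Delta_EKL Y p f \<phi> \<theta> = EKL Y p f \<phi> \<theta> - KL_pred Y p f \<theta>"

text \<open>Joint integrability of the Hessian over the observation and over each segment of length at
  most \<open>r\<close> starting at \<open>\<theta>\<close>, so that Fubini's theorem applies to the second-order Taylor remainder
  of the log-likelihood. It follows from a bound on \<open>E \<parallel>H(X, \<vartheta>)\<parallel>\<close> that is uniform for \<open>\<vartheta>\<close> in the
  ball of radius \<open>r\<close>, but not from a bound on \<open>\<parallel>E H(X, \<vartheta>)\<parallel>\<close>: positive and negative curvature
  may cancel at every \<open>\<vartheta>\<close> while the expected score jumps at \<open>\<theta>\<close>.\<close>

definition hessian_segment_integrable ::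
    "(real^'l) set \<Rightarrow> (real^'l \<Rightarrow> real) \<Rightarrow> (real^'l \<Rightarrow> real^'k \<Rightarrow> real) \<Rightarrow>
     real^'k \<Rightarrow> real \<Rightarrow> bool" where
  "hessian_segment_integrable Y p f \<theta> r \<longleftrightarrow>
     (\<forall>v. norm v \<le> r \<longrightarrow>
        integrable (law Y p \<Otimes>\<^sub>M lebesgue_on {0..1::real})
          (\<lambda>(x, u). score_hessian f x (\<theta> + u *\<^sub>R v)))"

end

theory Submission
  imports Defs
begin

text \<open>
  Let \<open>A\<close> be the inner product of the expected step with the expected score at \<open>\<theta>\<close>. The theorem
  holds because \<open>-A\<close> is the right derivative at \<open>\<kappa> = 0\<close> of the divergence change of the rule
  downscaled by \<open>\<kappa>\<close>, so that a nonzero \<open>A\<close> alone decides the sign of that change for small \<open>\<kappa>\<close>.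
  The quantitative form of this is
  \<open>\<bar>\<Delta>EKL(\<kappa>) + \<kappa> A\<bar> \<le> \<kappa>\<^sup>2 C D\<^sup>2\<close> for all small \<open>\<kappa> > 0\<close>, where \<open>D\<close> bounds the step and \<open>C\<close>
  bounds the spectral norm of the expected Hessian near \<open>\<theta>\<close>. The conclusion is then elementary
  (\<open>eventually_negative_iff_descent_rate_pos\<close>).

  In the difference of two divergences the entropy of the true density cancels, which leaves minus
  the expected increment of the log-likelihood. This is expanded to second order with the
  remainder in integral form (\<open>taylor_integral_remainder\<close>). Only the norm of the
  \<^emph>\<open>expected\<close> Hessian is bounded near \<open>\<theta>\<close>, not the expectation of the norm, so the remainder cannot be
  estimated for each observation separately. Fubini's theorem first moves the expectation inside
  the integral along the segment, where the quadratic form of the expected Hessian appears; this is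
  \<open>expected_taylor_remainder_bound\<close>, the step that carries the proof.

  The resulting expansion of the divergence as a function of the displacement
  (\<open>KL_pred_expansion\<close>) is uniform on a ball. The step is almost surely bounded by \<open>D\<close>, so for
  small \<open>\<kappa>\<close> the displacement \<open>\<kappa> \<Delta>\<phi>(y)\<close> lies in that ball for almost every \<open>y\<close>, and
  the expansion may be averaged over \<open>y\<close> (\<open>expected_quadratic_expansion\<close>). The expectation of the
  linear term factors into the two separate expectations of \<open>A\<close> because the observation that
  drives the step and the one at which the fit is evaluated are independent.
\<close>

section \<open>Second-order expansion along a segment\<close>

lemma has_derivative_gradient:
  assumes "g differentiable (at \<theta>)"
  shows "(g has_derivative (\<lambda>h. gradient g \<theta> \<bullet> h)) (at \<theta>)"
proof -
  have der: "(g has_derivative frechet_derivative g (at \<theta>)) (at \<theta>)"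
    using assms frechet_derivative_works by blast
  interpret linear "frechet_derivative g (at \<theta>)"
    using der by (rule has_derivative_linear)
  have "frechet_derivative g (at \<theta>) h = gradient g \<theta> \<bullet> h" for h
  proof -
    have "frechet_derivative g (at \<theta>) h
        = frechet_derivative g (at \<theta>) (\<Sum>i\<in>UNIV. (h $ i) *\<^sub>R axis i 1)"
      by (simp add: basis_expansion flip: scalar_mult_eq_scaleR)
    also have "\<dots> = gradient g \<theta> \<bullet> h"
      by (simp add: sum scale gradient_def inner_vec_def mult.commute)
    finally show ?thesis .
  qed
  with der show ?thesis by (metis (no_types, lifting) ext)
qed

lemma has_derivative_hessian:
  assumes "gradient g differentiable (at \<theta>)"
  shows "(gradient g has_derivative (\<lambda>h. hessian g \<theta> *v h)) (at \<theta>)"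
  using assms unfolding hessian_def by (simp add: jacobian_works)

lemma bounded_linear_quadratic_form:
  "bounded_linear (\<lambda>A::real^'k^'k. v \<bullet> (A *v v))"
  unfolding linear_conv_bounded_linear[symmetric]
  by (rule linearI) (simp_all add: matrix_vector_mult_add_rdistrib inner_add_right scaleR_matrix_vector_assoc[symmetric])

lemma integral_lebesgue_on_eq_of_has_integral:
  fixes h :: "real \<Rightarrow> real"
  assumes "continuous_on {a..b} h" "(h has_integral I) {a..b}"
  shows "(\<integral>u. h u \<partial>lebesgue_on {a..b}) = I"
proof -
  have "integrable (lebesgue_on {a..b}) h"
    using assms(1) by (intro continuous_imp_integrable_real)
  then show ?thesis
    using assms(2) by (simp add: lebesgue_integral_eq_integral integral_unique)
qed

text \<open>This is the fundamental theorem of calculus for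
  \<open>F u = (1 - u) \<gamma>'(u) + \<gamma>(u)\<close> with \<open>\<gamma>(u) = g (\<theta> + u v)\<close>: in
  \<open>F' u = (1 - u) \<gamma>''(u)\<close> the first-order terms cancel. The integral form of the remainder is
  used, rather than an intermediate point on the segment, since such a point would depend on the
  observation and could not be exchanged with an expectation.\<close>

lemma taylor_integral_remainder:
  assumes C2: "twice_continuously_differentiable_on g S"
    and seg: "\<And>u. u \<in> {0..1} \<Longrightarrow> \<theta> + u *\<^sub>R v \<in> S"
  shows "(\<integral>u. (1 - u) * (v \<bullet> (hessian g (\<theta> + u *\<^sub>R v) *v v)) \<partial>lebesgue_on {0..1})
           = g (\<theta> + v) - g \<theta> - gradient g \<theta> \<bullet> v"
proof -
  let ?\<gamma> = "\<lambda>u::real. \<theta> + u *\<^sub>R v"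
  let ?F = "\<lambda>u. (1 - u) * (gradient g (?\<gamma> u) \<bullet> v) + g (?\<gamma> u)"
  let ?F' = "\<lambda>u. (1 - u) * (v \<bullet> (hessian g (?\<gamma> u) *v v))"
  have dF: "(?F has_vector_derivative ?F' u) (at u within {0..1})" if u: "u \<in> {0..1}" for u
  proof -
    have path: "(?\<gamma> has_derivative (\<lambda>t. t *\<^sub>R v)) (at u)"
      by (auto intro!: derivative_eq_intros)
    have "g differentiable (at (?\<gamma> u))" "gradient g differentiable (at (?\<gamma> u))"
      using C2 seg[OF u] unfolding twice_continuously_differentiable_on_def by auto
    then have dg: "(g has_derivative (\<lambda>h. gradient g (?\<gamma> u) \<bullet> h)) (at (?\<gamma> u))"
      and dgr: "(gradient g has_derivative (\<lambda>h. hessian g (?\<gamma> u) *v h)) (at (?\<gamma> u))"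
      by (simp_all add: has_derivative_gradient has_derivative_hessian)
    have "((\<lambda>u. g (?\<gamma> u)) has_derivative (\<lambda>t. gradient g (?\<gamma> u) \<bullet> (t *\<^sub>R v))) (at u)"
      using has_derivative_compose[OF path dg] by simp
    moreover have "((\<lambda>u. gradient g (?\<gamma> u)) has_derivative (\<lambda>t. hessian g (?\<gamma> u) *v (t *\<^sub>R v))) (at u)"
      using has_derivative_compose[OF path dgr] by simp
    ultimately have "(?F has_derivative (\<lambda>t. t *\<^sub>R ?F' u)) (at u)"
      by (auto intro!: derivative_eq_intros simp: algebra_simps matrix_vector_mult_scaleR inner_commute)
    then show ?thesis
      by (simp add: has_vector_derivative_def has_derivative_at_withinI)
  qed
  have "(?F' has_integral (?F 1 - ?F 0)) {0..1}"
    by (rule fundamental_theorem_of_calculus) (use dF in auto)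
  moreover have "continuous_on {0..1} ?F'"
  proof -
    have "continuous_on {0..1} (\<lambda>u. hessian g (?\<gamma> u))"
      by (rule continuous_on_compose2[of S "hessian g"])
        (use C2 seg in \<open>auto simp: twice_continuously_differentiable_on_def intro!: continuous_intros\<close>)
    then show ?thesis
      by (intro continuous_intros bounded_linear.continuous_on[OF bounded_linear_quadratic_form])
  qed
  ultimately have "(\<integral>u. ?F' u \<partial>lebesgue_on {0..1}) = ?F 1 - ?F 0"
    by (rule integral_lebesgue_on_eq_of_has_integral[rotated])
  then show ?thesis by (simp add: algebra_simps)
qed

section \<open>Expectation of the remainder\<close>

lemma quadratic_form_le_spectral_norm:
  "\<bar>v \<bullet> (A *v v)\<bar> \<le> spectral_norm A * (norm v)\<^sup>2"
proof -
  have "\<bar>v \<bullet> (A *v v)\<bar> \<le> norm v * norm (A *v v)"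
    by (rule Cauchy_Schwarz_ineq2)
  also have "norm (A *v v) \<le> spectral_norm A * norm v"
    unfolding spectral_norm_def by (rule onorm) simp
  finally have "\<bar>v \<bullet> (A *v v)\<bar> \<le> norm v * (spectral_norm A * norm v)"
    by (simp add: mult_left_mono)
  then show ?thesis
    by (simp add: power2_eq_square ac_simps)
qed

text \<open>Cancellation between observations matters here: \<open>C\<close> bounds the Hessian only after averaging.
  Joint integrability on the product space allows the average over \<open>x\<close> to be taken before the
  one over \<open>u\<close>. The weight \<open>1 - u\<close> is estimated by \<open>1\<close>; the sharp constant \<open>C / 2\<close> would gain
  nothing for an expansion that is only used to first order.\<close>

lemma expected_taylor_remainder_bound:
  fixes g :: "'a \<Rightarrow> real^'k \<Rightarrow> real"
  assumes M: "prob_space M"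
    and C2: "\<And>x. x \<in> space M \<Longrightarrow> twice_continuously_differentiable_on (g x) S"
    and seg: "\<And>u. u \<in> {0..1} \<Longrightarrow> \<theta> + u *\<^sub>R v \<in> S"
    and int_diff: "integrable M (\<lambda>x. g x (\<theta> + v) - g x \<theta>)"
    and int_grad: "integrable M (\<lambda>x. gradient (g x) \<theta>)"
    and int_hess: "\<And>u. u \<in> {0..1} \<Longrightarrow> integrable M (\<lambda>x. hessian (g x) (\<theta> + u *\<^sub>R v))"
    and int_joint: "integrable (M \<Otimes>\<^sub>M lebesgue_on {0..1::real})
                      (\<lambda>(x, u). hessian (g x) (\<theta> + u *\<^sub>R v))"
    and bound: "\<And>u. u \<in> {0..1} \<Longrightarrow>
                  spectral_norm (\<integral>x. hessian (g x) (\<theta> + u *\<^sub>R v) \<partial>M) \<le> C"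
  shows "\<bar>(\<integral>x. g x (\<theta> + v) - g x \<theta> \<partial>M) - (\<integral>x. gradient (g x) \<theta> \<partial>M) \<bullet> v\<bar> \<le> C * (norm v)\<^sup>2"
proof -
  let ?L = "lebesgue_on {0..1::real}"
  let ?q = "\<lambda>x u. (1 - u) * (v \<bullet> (hessian (g x) (\<theta> + u *\<^sub>R v) *v v))"
  interpret M: prob_space M by fact
  interpret L: prob_space ?L
    by (rule prob_spaceI) (simp add: emeasure_restrict_space)
  interpret pair_sigma_finite M ?L ..
  have joint: "integrable (M \<Otimes>\<^sub>M ?L) (case_prod ?q)"
  proof (rule Bochner_Integration.integrable_bound)
    have "integrable (M \<Otimes>\<^sub>M ?L) (\<lambda>z. v \<bullet> ((case z of (x, u) \<Rightarrow> hessian (g x) (\<theta> + u *\<^sub>R v)) *v v))"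
      by (rule integrable_bounded_linear[OF bounded_linear_quadratic_form int_joint])
    then show form: "integrable (M \<Otimes>\<^sub>M ?L) (\<lambda>(x, u). v \<bullet> (hessian (g x) (\<theta> + u *\<^sub>R v) *v v))"
      by (simp add: case_prod_unfold)
    have "(\<lambda>u::real. 1 - u) \<in> borel_measurable ?L"
      by (intro measurable_restrict_space1 measurable_completion) simp
    then have "(\<lambda>z. 1 - snd z) \<in> borel_measurable (M \<Otimes>\<^sub>M ?L)"
      by (rule measurable_compose[OF measurable_snd])
    then have "(\<lambda>z. (1 - snd z) * (case z of (x, u) \<Rightarrow> v \<bullet> (hessian (g x) (\<theta> + u *\<^sub>R v) *v v)))
        \<in> borel_measurable (M \<Otimes>\<^sub>M ?L)"
      using form by (intro borel_measurable_times) auto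
    then show "case_prod ?q \<in> borel_measurable (M \<Otimes>\<^sub>M ?L)"
      by (simp add: case_prod_unfold)
    show "AE z in M \<Otimes>\<^sub>M ?L. norm (case_prod ?q z)
        \<le> norm (case z of (x, u) \<Rightarrow> v \<bullet> (hessian (g x) (\<theta> + u *\<^sub>R v) *v v))"
      by (rule AE_I2) (auto simp: space_pair_measure abs_mult intro!: mult_left_le_one_le)
  qed
  have "(\<integral>x. g x (\<theta> + v) - g x \<theta> \<partial>M) - (\<integral>x. gradient (g x) \<theta> \<partial>M) \<bullet> v
      = (\<integral>x. g x (\<theta> + v) - g x \<theta> - gradient (g x) \<theta> \<bullet> v \<partial>M)"
    using int_diff int_grad by simp
  also have "\<dots> = (\<integral>x. (\<integral>u. ?q x u \<partial>?L) \<partial>M)"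
    by (intro Bochner_Integration.integral_cong refl)
      (use taylor_integral_remainder[OF C2 seg] in auto)
  also have "\<dots> = (\<integral>u. (\<integral>x. ?q x u \<partial>M) \<partial>?L)"
    by (rule Fubini_integral[OF joint, symmetric])
  also have "\<bar>\<dots>\<bar> \<le> C * (norm v)\<^sup>2"
  proof -
    have "norm (\<integral>u. (\<integral>x. ?q x u \<partial>M) \<partial>?L) \<le> (\<integral>u. C * (norm v)\<^sup>2 \<partial>?L)"
    proof (rule Bochner_Integration.integral_norm_bound_integral)
      show "integrable ?L (\<lambda>u. \<integral>x. ?q x u \<partial>M)"
        by (rule integrable_snd[OF joint])
      fix u :: real assume "u \<in> space ?L"
      then have u: "u \<in> {0..1}" by simp
      let ?H = "\<integral>x. hessian (g x) (\<theta> + u *\<^sub>R v) \<partial>M"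
      have "(\<integral>x. ?q x u \<partial>M) = (1 - u) * (v \<bullet> (?H *v v))"
        using integral_bounded_linear[OF bounded_linear_quadratic_form int_hess[OF u], of v] by simp
      then have "norm (\<integral>x. ?q x u \<partial>M) \<le> \<bar>v \<bullet> (?H *v v)\<bar>"
        using u by (auto simp: abs_mult intro!: mult_left_le_one_le)
      also have "\<dots> \<le> spectral_norm ?H * (norm v)\<^sup>2"
        by (rule quadratic_form_le_spectral_norm)
      also have "\<dots> \<le> C * (norm v)\<^sup>2"
        by (intro mult_right_mono bound u) simp
      finally show "norm (\<integral>x. ?q x u \<partial>M) \<le> C * (norm v)\<^sup>2" .
    qed simp
    also have "\<dots> = C * (norm v)\<^sup>2" using L.prob_space by simp
    finally show ?thesis by simp
  qed
  finally show ?thesis .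
qed

section \<open>The divergence as a function of the parameter\<close>

lemma space_law: "space (law Y p) = Y"
  by (simp add: law_def space_restrict_space)

lemma prob_space_law:
  assumes "density_on Y p"
  shows "prob_space (law Y p)"
proof (rule prob_spaceI)
  have "(\<lambda>x. ennreal (p x)) \<in> borel_measurable (lebesgue_on Y)"
    using assms by (auto simp: density_on_def)
  then have "emeasure (law Y p) (space (lebesgue_on Y)) = (\<integral>\<^sup>+x. ennreal (p x) \<partial>lebesgue_on Y)"
    unfolding law_def by (subst emeasure_density) (auto intro!: nn_integral_cong simp: space_restrict_space)
  then show "emeasure (law Y p) (space (law Y p)) = 1"
    using assms by (simp add: density_on_def law_def)
qed

lemma AE_law_density_pos:
  assumes "density_on Y p"
  shows "AE x in law Y p. x \<in> Y \<and> 0 < p x"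
proof -
  have "(\<lambda>x. ennreal (p x)) \<in> borel_measurable (lebesgue_on Y)"
    using assms by (auto simp: density_on_def)
  then show ?thesis
    unfolding law_def by (subst AE_density) (auto intro!: AE_I2 simp: space_restrict_space)
qed

lemma ln_density_measurable_law:
  assumes "density_on Y q"
  shows "(\<lambda>x. ln (q x)) \<in> borel_measurable (law Y p)"
  using assms unfolding density_on_def law_def by (simp add: borel_measurable_ln)

text \<open>The support condition is what makes this true: \<open>ln\<close> splits over the quotient only where the
  model densities are positive, and almost every observation lies where the true density is positive.\<close>

lemma AE_law_log_ratio_diff:
  assumes p: "density_on Y p"
    and f: "density_on Y (\<lambda>x. f x \<theta>)" "density_on Y (\<lambda>x. f x \<eta>)"
    and supp: "{x\<in>Y. p x \<noteq> 0} \<subseteq> {x\<in>Y. f x \<theta> \<noteq> 0}" "{x\<in>Y. p x \<noteq> 0} \<subseteq> {x\<in>Y. f x \<eta> \<noteq> 0}"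
  shows "AE x in law Y p. ln (p x / f x \<theta>) - ln (p x / f x \<eta>) = ln (f x \<eta>) - ln (f x \<theta>)"
  using AE_law_density_pos[OF p]
proof (rule AE_mp, intro AE_I2 impI)
  fix x assume x: "x \<in> Y \<and> 0 < p x"
  then have "0 < f x \<theta>" "0 < f x \<eta>"
    using f supp unfolding density_on_def by (auto simp: order_less_le)
  with x show "ln (p x / f x \<theta>) - ln (p x / f x \<eta>) = ln (f x \<eta>) - ln (f x \<theta>)"
    by (simp add: ln_div)
qed


text \<open>The gradient of the divergence is minus the expected score, hence the plus sign. Integrability
  of the log-likelihood increment is inherited from the two divergences, although the
  log-likelihoods need not be integrable themselves.\<close>

lemma KL_pred_expansion:
  assumes p: "density_on Y p"
    and f: "density_on Y (\<lambda>x. f x \<theta>)" "density_on Y (\<lambda>x. f x (\<theta> + v))"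
    and supp: "{x\<in>Y. p x \<noteq> 0} \<subseteq> {x\<in>Y. f x \<theta> \<noteq> 0}"
              "{x\<in>Y. p x \<noteq> 0} \<subseteq> {x\<in>Y. f x (\<theta> + v) \<noteq> 0}"
    and fin: "KL_pred_finite Y p f \<theta>" "KL_pred_finite Y p f (\<theta> + v)"
    and C2: "\<And>x. x \<in> Y \<Longrightarrow> twice_continuously_differentiable_on (\<lambda>\<theta>. ln (f x \<theta>)) S"
    and seg: "\<And>u. u \<in> {0..1} \<Longrightarrow> \<theta> + u *\<^sub>R v \<in> S"
    and int_score: "integrable (law Y p) (\<lambda>x. score f x \<theta>)"
    and int_hess: "\<And>u. u \<in> {0..1} \<Longrightarrow> integrable (law Y p) (\<lambda>x. score_hessian f x (\<theta> + u *\<^sub>R v))"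
    and int_joint: "integrable (law Y p \<Otimes>\<^sub>M lebesgue_on {0..1::real})
                      (\<lambda>(x, u). score_hessian f x (\<theta> + u *\<^sub>R v))"
    and bound: "\<And>u. u \<in> {0..1} \<Longrightarrow>
                  spectral_norm (\<integral>x. score_hessian f x (\<theta> + u *\<^sub>R v) \<partial>law Y p) \<le> C"
  shows "\<bar>KL_pred Y p f (\<theta> + v) - KL_pred Y p f \<theta> + (\<integral>x. score f x \<theta> \<partial>law Y p) \<bullet> v\<bar>
           \<le> C * (norm v)\<^sup>2"
proof -
  let ?M = "law Y p"
  have fin': "integrable ?M (\<lambda>x. ln (p x / f x \<theta>))" "integrable ?M (\<lambda>x. ln (p x / f x (\<theta> + v)))"
    using fin by (simp_all add: KL_pred_finite_def)
  have meas: "(\<lambda>x. ln (f x (\<theta> + v)) - ln (f x \<theta>)) \<in> borel_measurable ?M"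
    using f by (intro borel_measurable_diff ln_density_measurable_law)
  note ae = AE_law_log_ratio_diff[OF p f supp]
  have int_diff: "integrable ?M (\<lambda>x. ln (f x (\<theta> + v)) - ln (f x \<theta>))"
    using integrable_cong_AE_imp[OF Bochner_Integration.integrable_diff[OF fin'] meas ae] .
  have "(\<integral>x. ln (f x (\<theta> + v)) - ln (f x \<theta>) \<partial>?M)
      = (\<integral>x. ln (p x / f x \<theta>) - ln (p x / f x (\<theta> + v)) \<partial>?M)"
    by (rule integral_cong_AE[OF meas]) (use fin' ae in auto)
  also have "\<dots> = KL_pred Y p f \<theta> - KL_pred Y p f (\<theta> + v)"
    using fin' by (simp add: KL_pred_def)
  finally have eq: "(\<integral>x. ln (f x (\<theta> + v)) - ln (f x \<theta>) \<partial>?M)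
      = KL_pred Y p f \<theta> - KL_pred Y p f (\<theta> + v)" .
  have "\<bar>(\<integral>x. ln (f x (\<theta> + v)) - ln (f x \<theta>) \<partial>?M) - (\<integral>x. score f x \<theta> \<partial>?M) \<bullet> v\<bar>
      \<le> C * (norm v)\<^sup>2"
    using expected_taylor_remainder_bound[OF prob_space_law[OF p], of "\<lambda>x \<eta>. ln (f x \<eta>)" S \<theta> v C]
      C2 seg int_diff int_score int_hess int_joint bound
    by (simp add: space_law score_def score_hessian_def)
  then show ?thesis unfolding eq by linarith
qed

section \<open>Averaging over the random step\<close>

text \<open>Since the expansion of \<open>K\<close> is uniform on the ball of radius \<open>r\<close>, scaling the step \<open>\<delta>\<close> so
  that it stays in the ball makes the error at most \<open>C (\<kappa> D)\<^sup>2\<close> for almost every outcome.\<close>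

lemma expected_quadratic_expansion:
  fixes K :: "real^'k \<Rightarrow> real" and \<delta> :: "'a \<Rightarrow> real^'k"
  assumes M: "prob_space M"
    and exp: "\<And>v. norm v \<le> r \<Longrightarrow> \<bar>K (\<theta> + v) - K \<theta> + S \<bullet> v\<bar> \<le> C * (norm v)\<^sup>2"
    and meas: "\<delta> \<in> borel_measurable M"
    and bounded: "AE y in M. norm (\<delta> y) \<le> D"
    and intK: "integrable M (\<lambda>y. K (\<theta> + \<kappa> *\<^sub>R \<delta> y))"
    and "0 < \<kappa>" "\<kappa> * D \<le> r" "0 \<le> C"
  shows "\<bar>(\<integral>y. K (\<theta> + \<kappa> *\<^sub>R \<delta> y) \<partial>M) - K \<theta> + \<kappa> * ((\<integral>y. \<delta> y \<partial>M) \<bullet> S)\<bar> \<le> \<kappa>\<^sup>2 * (C * D\<^sup>2)"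
proof -
  interpret prob_space M by fact
  let ?R = "\<lambda>y. K (\<theta> + \<kappa> *\<^sub>R \<delta> y) - K \<theta> + \<kappa> * (\<delta> y \<bullet> S)"
  have int_step: "integrable M \<delta>"
    by (rule integrable_const_bound[OF bounded meas])
  then have intR: "integrable M ?R" using intK by simp
  have "(\<integral>y. K (\<theta> + \<kappa> *\<^sub>R \<delta> y) \<partial>M) - K \<theta> + \<kappa> * ((\<integral>y. \<delta> y \<partial>M) \<bullet> S) = (\<integral>y. ?R y \<partial>M)"
    using intK int_step by (simp add: prob_space)
  also have "\<bar>\<dots>\<bar> \<le> (\<integral>y. \<bar>?R y\<bar> \<partial>M)"
    by (rule integral_abs_bound)
  also have "\<dots> \<le> (\<integral>y. \<kappa>\<^sup>2 * (C * D\<^sup>2) \<partial>M)"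
  proof (rule integral_mono_AE)
    show "AE y in M. \<bar>?R y\<bar> \<le> \<kappa>\<^sup>2 * (C * D\<^sup>2)"
      using bounded
    proof (rule AE_mp, intro AE_I2 impI)
      fix y assume y: "norm (\<delta> y) \<le> D"
      have "norm (\<kappa> *\<^sub>R \<delta> y) \<le> \<kappa> * D"
        using y \<open>0 < \<kappa>\<close> by simp
      then have "\<bar>?R y\<bar> \<le> C * (norm (\<kappa> *\<^sub>R \<delta> y))\<^sup>2"
        using exp[of "\<kappa> *\<^sub>R \<delta> y"] \<open>\<kappa> * D \<le> r\<close> by (simp add: inner_commute)
      also have "\<dots> \<le> C * (\<kappa> * D)\<^sup>2"
        using \<open>norm (\<kappa> *\<^sub>R \<delta> y) \<le> \<kappa> * D\<close> \<open>0 \<le> C\<close> by (intro mult_left_mono power_mono) auto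
      finally show "\<bar>?R y\<bar> \<le> \<kappa>\<^sup>2 * (C * D\<^sup>2)" by (simp add: power_mult_distrib ac_simps)
    qed
  qed (use intR in auto)
  finally show ?thesis by (simp add: prob_space)
qed

text \<open>For \<open>\<kappa>\<close> up to \<open>\<kappa>0\<close> and \<open>\<bar>A\<bar> / (B + 1)\<close> the linear term dominates the quadratic error, so \<open>h\<close> has the sign of
  \<open>-A\<close> there. If \<open>A < 0\<close>, then \<open>h\<close> is positive arbitrarily close to \<open>0\<close>, which no \<open>\<kappa>max\<close>
  survives.\<close>

lemma eventually_negative_iff_descent_rate_pos:
  fixes h :: "real \<Rightarrow> real"
  assumes exp: "\<And>\<kappa>. 0 < \<kappa> \<Longrightarrow> \<kappa> \<le> \<kappa>0 \<Longrightarrow> \<bar>h \<kappa> + \<kappa> * A\<bar> \<le> \<kappa>\<^sup>2 * B"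
    and "0 < \<kappa>0" "0 \<le> B" "A \<noteq> 0"
  shows "A > 0 \<longleftrightarrow> (\<exists>\<kappa>max>0. \<kappa>max \<le> 1 \<and> (\<forall>\<kappa>. 0 < \<kappa> \<and> \<kappa> \<le> \<kappa>max \<longrightarrow> h \<kappa> < 0))"
proof -
  define \<kappa>1 where "\<kappa>1 = min (min \<kappa>0 1) (\<bar>A\<bar> / (B + 1))"
  have \<kappa>1: "0 < \<kappa>1" "\<kappa>1 \<le> 1" "\<kappa>1 \<le> \<kappa>0" "\<kappa>1 \<le> \<bar>A\<bar> / (B + 1)"
    using assms by (auto simp: \<kappa>1_def)
  have small: "\<bar>h \<kappa> + \<kappa> * A\<bar> < \<kappa> * \<bar>A\<bar>" if "0 < \<kappa>" "\<kappa> \<le> \<kappa>1" for \<kappa>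
  proof -
    have "\<kappa> \<le> \<bar>A\<bar> / (B + 1)" using that \<kappa>1 by linarith
    then have "\<kappa> * (B + 1) \<le> \<bar>A\<bar>" using \<open>0 \<le> B\<close> by (simp add: pos_le_divide_eq)
    then have "\<kappa> * B < \<bar>A\<bar>" using \<open>0 < \<kappa>\<close> by (simp add: distrib_left)
    then have "\<kappa>\<^sup>2 * B < \<kappa> * \<bar>A\<bar>" using \<open>0 < \<kappa>\<close> by (simp add: power2_eq_square)
    then show ?thesis using exp[of \<kappa>] that \<kappa>1 by linarith
  qed
  show ?thesis
  proof
    assume "A > 0"
    then have "h \<kappa> < 0" if "0 < \<kappa>" "\<kappa> \<le> \<kappa>1" for \<kappa>
      using small[OF that] by auto
    with \<kappa>1 show "\<exists>\<kappa>max>0. \<kappa>max \<le> 1 \<and> (\<forall>\<kappa>. 0 < \<kappa> \<and> \<kappa> \<le> \<kappa>max \<longrightarrow> h \<kappa> < 0)" by blast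
  next
    assume "\<exists>\<kappa>max>0. \<kappa>max \<le> 1 \<and> (\<forall>\<kappa>. 0 < \<kappa> \<and> \<kappa> \<le> \<kappa>max \<longrightarrow> h \<kappa> < 0)"
    then obtain \<kappa>max where "\<kappa>max > 0" and neg: "\<And>\<kappa>. 0 < \<kappa> \<Longrightarrow> \<kappa> \<le> \<kappa>max \<Longrightarrow> h \<kappa> < 0" by blast
    define \<kappa> where "\<kappa> = min \<kappa>1 \<kappa>max"
    have \<kappa>: "0 < \<kappa>" "\<kappa> \<le> \<kappa>1" "\<kappa> \<le> \<kappa>max"
      using \<kappa>1 \<open>\<kappa>max > 0\<close> by (auto simp: \<kappa>_def)
    have "- \<kappa> * A < \<kappa> * \<bar>A\<bar>"
      using small[OF \<kappa>(1,2)] neg[OF \<kappa>(1,3)] by linarith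
    then show "A > 0" using \<open>0 < \<kappa>\<close> \<open>A \<noteq> 0\<close> by (cases "A > 0") auto
  qed
qed

section \<open>Downscaled updating rules\<close>

theorem theorem2:
  fixes Y :: "(real^'l) set"
    and \<Theta> :: "(real^'k) set"
    and P :: "(real^'l \<Rightarrow> real) set"
    and f :: "real^'l \<Rightarrow> real^'k \<Rightarrow> real"
    and \<phi> :: "real^'l \<Rightarrow> real^'k \<Rightarrow> real^'k"
    and d :: "real^'k \<Rightarrow> real"
  assumes Y: "Y \<in> sets lebesgue"
    and true_densities: "\<And>p. p \<in> P \<Longrightarrow> density_on Y p"
    and model_densities: "\<And>\<theta>. \<theta> \<in> \<Theta> \<Longrightarrow> density_on Y (\<lambda>x. f x \<theta>)"
    and supports: "\<And>p \<theta>. p \<in> P \<Longrightarrow> \<theta> \<in> \<Theta> \<Longrightarrow> {x\<in>Y. p x \<noteq> 0} \<subseteq> {x\<in>Y. f x \<theta> \<noteq> 0}"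
    and rule_measurable: "\<And>\<theta>. \<theta> \<in> \<Theta> \<Longrightarrow> (\<lambda>y. \<phi> y \<theta>) \<in> borel_measurable (lebesgue_on Y)"
    and finite_pred: "\<And>p \<theta>. p \<in> P \<Longrightarrow> \<theta> \<in> \<Theta> \<Longrightarrow> KL_pred_finite Y p f \<theta>"
    and finite_upd: "\<And>p \<theta> \<kappa>. p \<in> P \<Longrightarrow> \<theta> \<in> \<Theta> \<Longrightarrow> 0 < \<kappa> \<Longrightarrow> \<kappa> \<le> 1 \<Longrightarrow>
          EKL_finite Y p f (downscaled \<phi> \<kappa>) \<theta>"
    and open_convex: "open \<Theta>" "convex \<Theta>"
    and rule_into: "\<And>p \<theta>. p \<in> P \<Longrightarrow> \<theta> \<in> \<Theta> \<Longrightarrow> AE y in law Y p. \<phi> y \<theta> \<in> \<Theta>"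
    and C2: "\<And>x. x \<in> Y \<Longrightarrow> twice_continuously_differentiable_on (\<lambda>\<theta>. ln (f x \<theta>)) \<Theta>"
    and score_finite: "\<And>p \<theta>. p \<in> P \<Longrightarrow> \<theta> \<in> \<Theta> \<Longrightarrow> integrable (law Y p) (\<lambda>x. score f x \<theta>)"
    and step_finite: "\<And>p \<theta>. p \<in> P \<Longrightarrow> \<theta> \<in> \<Theta> \<Longrightarrow>
          integrable (law Y p) (\<lambda>y. (norm (update_step \<phi> y \<theta>))\<^sup>2)"
    and hessian_bounded: "\<And>\<theta>. \<theta> \<in> \<Theta> \<Longrightarrow> \<exists>r>0. cball \<theta> r \<subseteq> \<Theta> \<and>
          (\<forall>p\<in>P.
             (\<forall>\<eta>\<in>cball \<theta> r. integrable (law Y p) (\<lambda>x. score_hessian f x \<eta>)) \<and>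
             bdd_above ((\<lambda>\<eta>. spectral_norm (\<integral>x. score_hessian f x \<eta> \<partial>law Y p)) ` cball \<theta> r))"
    and hessian_fubini: "\<And>p \<theta>. p \<in> P \<Longrightarrow> \<theta> \<in> \<Theta> \<Longrightarrow>
          \<exists>r>0. hessian_segment_integrable Y p f \<theta> r"
    and step_bounded: "\<And>p \<theta>. p \<in> P \<Longrightarrow> \<theta> \<in> \<Theta> \<Longrightarrow>
          AE y in law Y p. norm (update_step \<phi> y \<theta>) \<le> d \<theta>"
  shows "\<forall>\<theta>\<in>\<Theta>. \<forall>p\<in>P.
     (\<integral>y. update_step \<phi> y \<theta> \<partial>law Y p) \<bullet> (\<integral>x. score f x \<theta> \<partial>law Y p) \<noteq> 0 \<longrightarrow>
     ((\<integral>y. update_step \<phi> y \<theta> \<partial>law Y p) \<bullet> (\<integral>x. score f x \<theta> \<partial>law Y p) > 0 \<longleftrightarrow>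
      (\<exists>\<kappa>max>0. \<kappa>max \<le> 1 \<and>
         (\<forall>\<kappa>. 0 < \<kappa> \<and> \<kappa> \<le> \<kappa>max \<longrightarrow> Delta_EKL Y p f (downscaled \<phi> \<kappa>) \<theta> < 0)))"
proof (intro ballI impI)
  fix \<theta> p
  assume \<theta>: "\<theta> \<in> \<Theta>" and p: "p \<in> P"
  let ?M = "law Y p"
  let ?S = "\<integral>x. score f x \<theta> \<partial>?M"
  let ?A = "(\<integral>y. update_step \<phi> y \<theta> \<partial>?M) \<bullet> ?S"
  assume A: "?A \<noteq> 0"
  note p_density = true_densities[OF p]
  obtain r1 where "0 < r1" and ball: "cball \<theta> r1 \<subseteq> \<Theta>"
    and int_hess: "\<And>\<eta>. \<eta> \<in> cball \<theta> r1 \<Longrightarrow> integrable ?M (\<lambda>x. score_hessian f x \<eta>)"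
    and bdd: "bdd_above ((\<lambda>\<eta>. spectral_norm (\<integral>x. score_hessian f x \<eta> \<partial>?M)) ` cball \<theta> r1)"
    using hessian_bounded[OF \<theta>] p by blast
  obtain r2 where "0 < r2" and fub: "hessian_segment_integrable Y p f \<theta> r2"
    using hessian_fubini[OF p \<theta>] by blast
  obtain C where C: "\<And>\<eta>. \<eta> \<in> cball \<theta> r1 \<Longrightarrow> spectral_norm (\<integral>x. score_hessian f x \<eta> \<partial>?M) \<le> C"
    using bdd unfolding bdd_above_def by blast
  have "0 \<le> C"
    using C[of \<theta>] \<open>0 < r1\<close> onorm_pos_le[OF matrix_vector_mul_bounded_linear]
    unfolding spectral_norm_def by (meson centre_in_cball less_imp_le order_trans)
  define r where "r = min r1 r2"
  have r: "0 < r" "r \<le> r1" "r \<le> r2"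
    using \<open>0 < r1\<close> \<open>0 < r2\<close> by (auto simp: r_def)
  have expansion: "\<bar>KL_pred Y p f (\<theta> + v) - KL_pred Y p f \<theta> + ?S \<bullet> v\<bar> \<le> C * (norm v)\<^sup>2"
    if v: "norm v \<le> r" for v
  proof -
    have seg: "\<theta> + u *\<^sub>R v \<in> cball \<theta> r1" if "u \<in> {0..1}" for u
    proof -
      have "\<bar>u\<bar> * norm v \<le> 1 * norm v"
        using that by (intro mult_right_mono) auto
      then show ?thesis using v r by (simp add: dist_norm)
    qed
    have \<theta>v: "\<theta> + v \<in> \<Theta>" using seg[of 1] ball by auto
    show ?thesis
    proof (rule KL_pred_expansion[OF p_density model_densities[OF \<theta>] model_densities[OF \<theta>v]
          supports[OF p \<theta>] supports[OF p \<theta>v] finite_pred[OF p \<theta>] finite_pred[OF p \<theta>v] C2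
          _ score_finite[OF p \<theta>]])
      show "integrable (?M \<Otimes>\<^sub>M lebesgue_on {0..1::real}) (\<lambda>(x, u). score_hessian f x (\<theta> + u *\<^sub>R v))"
        using fub v r unfolding hessian_segment_integrable_def by auto
    qed (use seg ball int_hess C in auto)
  qed
  \<comment> \<open>The absolute value makes the bound nonnegative, so that \<open>D + 1\<close> below is a positive divisor.\<close>
  define D where "D = \<bar>d \<theta>\<bar>"
  have D: "AE y in ?M. norm (update_step \<phi> y \<theta>) \<le> D"
    using step_bounded[OF p \<theta>] by (rule AE_mp) (auto simp: D_def)
  have step_meas: "(\<lambda>y. update_step \<phi> y \<theta>) \<in> borel_measurable ?M"
    using rule_measurable[OF \<theta>] unfolding update_step_def law_def by simp
  define \<kappa>0 where "\<kappa>0 = min 1 (r / (D + 1))"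
  have "0 < \<kappa>0" using r by (auto simp: \<kappa>0_def D_def)
  have "\<bar>Delta_EKL Y p f (downscaled \<phi> \<kappa>) \<theta> + \<kappa> * ?A\<bar> \<le> \<kappa>\<^sup>2 * (C * D\<^sup>2)"
    if \<kappa>: "0 < \<kappa>" "\<kappa> \<le> \<kappa>0" for \<kappa>
  proof -
    have "\<kappa> \<le> 1" "\<kappa> \<le> r / (D + 1)" using \<kappa> by (auto simp: \<kappa>0_def)
    then have "\<kappa> * (D + 1) \<le> r" by (simp add: pos_le_divide_eq D_def)
    then have "\<kappa> * D \<le> r" using \<kappa> by (simp add: distrib_left)
    have "integrable ?M (\<lambda>y. KL_pred Y p f (\<theta> + \<kappa> *\<^sub>R update_step \<phi> y \<theta>))"
      using finite_upd[OF p \<theta> \<kappa>(1) \<open>\<kappa> \<le> 1\<close>]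
      by (simp add: EKL_finite_def KL_pred_def downscaled_def)
    from expected_quadratic_expansion[OF prob_space_law[OF p_density] expansion step_meas D this
        \<kappa>(1) \<open>\<kappa> * D \<le> r\<close> \<open>0 \<le> C\<close>]
    show ?thesis
      by (simp add: Delta_EKL_def EKL_def KL_pred_def downscaled_def)
  qed
  from eventually_negative_iff_descent_rate_pos[OF this \<open>0 < \<kappa>0\<close> _ A]
  show "?A > 0 \<longleftrightarrow> (\<exists>\<kappa>max>0. \<kappa>max \<le> 1 \<and>
      (\<forall>\<kappa>. 0 < \<kappa> \<and> \<kappa> \<le> \<kappa>max \<longrightarrow> Delta_EKL Y p f (downscaled \<phi> \<kappa>) \<theta> < 0))"
    using \<open>0 \<le> C\<close> by simp
qed

end
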